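(* For every real number $x$ and every integer $n\ge 0$, $$G_n(x)=\sum_{k=0}^n\binom xk^2(-1)^{n-k}\binom{-1-x}{n-k}.$$
   Context: For a real number $x$ and an integer $k\ge0$, $\binom xk=x(x-1)\cdots(x-k+1)/k!$ (with $\binom x0=1$). Define $G_n(x)=\sum_{k=0}^n\binom nk(-1)^k\binom xk\binom{-1-x}k$ for $n=0,1,2,\ldots$. *)

theory Defs
  imports Complex_Main
begin

definition G :: "nat \<Rightarrow> real \<Rightarrow> real" where
  "G n x = (\<Sum>k = 0..n. real (n choose k) * (-1) ^ k * (x gchoose k) * ((-1 - x) gchoose k))"

end

theory Submission
  imports Defs "HOL-Computational_Algebra.Formal_Power_Series"
begin

text \<open>Write \<open>y = -1 - x\<close>. Chu--Vandermonde together with trinomial revision expands one square as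
  \<open>(x gchoose j)\<^sup>2 = (-1)^j * (\<Sum>k\<le>j. (x gchoose k) * (y gchoose k) * (x - k gchoose (j - k)))\<close>.
  Inserting this in the right-hand side and exchanging the sums, the inner sum
  over \<open>j\<close> is again a Chu--Vandermonde convolution, with value
  \<open>(-1 - k gchoose (n - k)) = (-1)^(n - k) * (n choose k)\<close>.\<close>

text \<open>By the symmetry of \<open>n choose k\<close>, this is the Chu--Vandermonde convolution
  with upper arguments \<open>a\<close> and \<open>n\<close>.\<close>

lemma sum_choose_gchoose:
  fixes a :: "'a::field_char_0"
  shows "(\<Sum>k = 0..n. of_nat (n choose k) * (a gchoose k)) = (a + of_nat n gchoose n)"
proof -
  have "(\<Sum>k = 0..n. of_nat (n choose k) * (a gchoose k))
      = (\<Sum>k = 0..n. (a gchoose k) * (of_nat n gchoose (n - k)))"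
    by (intro sum.cong)
      (auto simp: binomial_gbinomial [symmetric] binomial_symmetric [symmetric] mult.commute)
  then show ?thesis
    by (simp add: gbinomial_Vandermonde)
qed

text \<open>Trinomial revision pulls the factor \<open>x gchoose j\<close> out of the sum. What
  remains sums to \<open>j - x - 1 gchoose j\<close>, which upper negation turns into a second copy
  of \<open>x gchoose j\<close>, up to the sign \<open>(-1) ^ j\<close>.\<close>

lemma gbinomial_square_expansion:
  fixes x :: "'a::field_char_0"
  shows "(x gchoose j)\<^sup>2 =
    (-1) ^ j * (\<Sum>k = 0..j. (x gchoose k) * (-1 - x gchoose k) * (x - of_nat k gchoose (j - k)))"
proof -
  have "(\<Sum>k = 0..j. (x gchoose k) * (-1 - x gchoose k) * (x - of_nat k gchoose (j - k)))
      = (\<Sum>k = 0..j. (x gchoose j) * (of_nat (j choose k) * (-1 - x gchoose k)))"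
  proof (intro sum.cong refl)
    fix k assume "k \<in> {0..j}"
    then have "(x gchoose j) * of_nat (j choose k) = (x gchoose k) * (x - of_nat k gchoose (j - k))"
      using gbinomial_trinomial_revision [of k j x] by (simp add: binomial_gbinomial)
    then show "(x gchoose k) * (-1 - x gchoose k) * (x - of_nat k gchoose (j - k))
      = (x gchoose j) * (of_nat (j choose k) * (-1 - x gchoose k))"
      by (metis mult.assoc mult.commute)
  qed
  also have "\<dots> = (x gchoose j) * (of_nat j - x - 1 gchoose j)"
    by (simp add: sum_distrib_left [symmetric] sum_choose_gchoose algebra_simps)
  finally show ?thesis
    by (simp add: gbinomial_negated_upper [of x j] power2_eq_square)
qed

text \<open>The upper arguments add up to \<open>-1 - k\<close>, so the convolution no longer
  depends on \<open>x\<close>; upper negation then makes the upper argument exactly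
  \<open>n\<close>.\<close>

lemma convolution_eq_choose:
  fixes x :: "'a::field_char_0"
  assumes "k \<le> n"
  shows "(\<Sum>j = k..n. (x - of_nat k gchoose (j - k)) * (-1 - x gchoose (n - j)))
    = (-1) ^ (n - k) * of_nat (n choose k)"
proof -
  have "(\<Sum>j = k..n. (x - of_nat k gchoose (j - k)) * (-1 - x gchoose (n - j)))
      = (\<Sum>i = 0..n - k. (x - of_nat k gchoose i) * (-1 - x gchoose (n - k - i)))"
    by (rule sum.reindex_bij_witness [where i = "\<lambda>i. i + k" and j = "\<lambda>j. j - k"])
      (use assms in auto)
  also have "\<dots> = (-1 - of_nat k gchoose (n - k))"
    by (subst gbinomial_Vandermonde) (simp add: algebra_simps)
  also have "\<dots> = (-1) ^ (n - k) * (of_nat n gchoose (n - k))"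
    using assms by (simp add: gbinomial_negated_upper [of "-1 - of_nat k"] of_nat_diff)
  also have "\<dots> = (-1) ^ (n - k) * of_nat (n choose k)"
    using assms by (simp add: binomial_gbinomial [symmetric] binomial_symmetric [symmetric])
  finally show ?thesis .
qed

theorem theorem3p1:
  fixes x :: real and n :: nat
  shows "G n x = (\<Sum>k = 0..n. (x gchoose k)^2 * (-1) ^ (n - k) * ((-1 - x) gchoose (n - k)))"
proof -
  let ?y = "-1 - x"
  have "(\<Sum>j = 0..n. (x gchoose j)^2 * (-1) ^ (n - j) * (?y gchoose (n - j)))
      = (\<Sum>j = 0..n. \<Sum>k = 0..j. (-1) ^ n * ((x gchoose k) * (?y gchoose k))
          * ((x - of_nat k gchoose (j - k)) * (?y gchoose (n - j))))"
  proof (intro sum.cong refl)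
    fix j assume "j \<in> {0..n}"
    \<comment> \<open>The sign of the expanded square merges with \<open>(-1) ^ (n - j)\<close> into
      a sign independent of \<open>j\<close>, so it can leave the inner sum after the
      exchange.\<close>
    then have "(-1::real) ^ n = (-1) ^ j * (-1) ^ (n - j)"
      by (simp flip: power_add)
    then show "(x gchoose j)^2 * (-1) ^ (n - j) * (?y gchoose (n - j))
      = (\<Sum>k = 0..j. (-1) ^ n * ((x gchoose k) * (?y gchoose k))
          * ((x - of_nat k gchoose (j - k)) * (?y gchoose (n - j))))"
      by (simp add: gbinomial_square_expansion sum_distrib_left sum_distrib_right mult_ac)
  qed
  \<comment> \<open>Both double sums run over the triangle \<open>k \<le> j \<le> n\<close>;
    swapping the coordinates is the bijection.\<close>
  also have "\<dots> = (\<Sum>k = 0..n. \<Sum>j = k..n. (-1) ^ n * ((x gchoose k) * (?y gchoose k))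
          * ((x - of_nat k gchoose (j - k)) * (?y gchoose (n - j))))"
    by (simp add: sum.Sigma, rule sum.reindex_bij_witness
        [where i = "\<lambda>(a, b). (b, a)" and j = "\<lambda>(a, b). (b, a)"]) auto
  also have "\<dots> = (\<Sum>k = 0..n. (-1) ^ n * ((x gchoose k) * (?y gchoose k))
          * ((-1) ^ (n - k) * of_nat (n choose k)))"
    by (intro sum.cong refl)
      (simp only: sum_distrib_left [symmetric] convolution_eq_choose atLeastAtMost_iff)
  also have "\<dots> = G n x"
    unfolding G_def
  proof (intro sum.cong refl)
    fix k assume "k \<in> {0..n}"
    \<comment> \<open>The two factors \<open>(-1) ^ (n - k)\<close> cancel, leaving the sign
      \<open>(-1) ^ k\<close> of \<open>G\<close>.\<close>
    then have "(-1::real) ^ n = (-1) ^ k * (-1) ^ (n - k)"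
      by (simp flip: power_add)
    then show "(-1) ^ n * ((x gchoose k) * (?y gchoose k)) * ((-1) ^ (n - k) * of_nat (n choose k))
      = real (n choose k) * (-1) ^ k * (x gchoose k) * (?y gchoose k)"
      by simp
  qed
  finally show ?thesis ..
qed

end
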